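(* Consider the critical-peak-pricing (CPP) scheduling problem $$\min_{u_t,\ t=1,\dots,T}\ \mathbb{E}\Big[\sum_{t=1}^T c^{\mathrm{power}}_{t+1}(q_{t+1}(\mathbf{X}_{t+1}))(1-u_t)+c^{\mathrm{power}}_{t+1}(q_{t+1}(\mathbf{X}_{t+1})-y)\,u_t+\overline{a}_{t+1}u_t\Big]\quad\text{subject to } u_t\in\{0,1\},\ \sum_{t=1}^Tu_t\le M.$$ The optimal CPP scheduling policy is as follows. At day $d=T-t$, given the observations $\mathbf{X}_d=\mathbf{x}$, a CPP event is called for the following day, i.e. $u_d=1$, if $$\mathbb{E}[q_{d-1}(\mathbf{X}_{d-1})\mid\mathbf{X}_d=\mathbf{x}]\ >\ \frac{1}{2yB_{d-1}}\Big(g_{d-1}(k-1|\mathbf{x})-g_{d-1}(k|\mathbf{x})+\overline{a}_{d-1}-C_{d-1}y+B_{d-1}y^2\Big),$$ where $$g_d(k|\mathbf{X}_{d+1}=\mathbf{x})=\sum_{\boldsymbol{\xi}\in\mathcal{X}}\min\Big\{g_{d-1}(k|\boldsymbol{\xi})+\mathbb{E}[c^{\mathrm{power}}_{d-1}(q_{d-1}(\mathbf{X}_{d-1}))\mid\mathbf{X}_d=\boldsymbol{\xi}],\ g_{d-1}(k-1|\boldsymbol{\xi})+\overline{a}_{d-1}+\mathbb{E}[c^{\mathrm{power}}_{d-1}(q_{d-1}(\mathbf{X}_{d-1})-y)\mid\mathbf{X}_d=\boldsymbol{\xi}]\Big\}\Pr[\mathbf{X}_d=\boldsymbol{\xi}\mid\mathbf{X}_{d+1}=\mathbf{x}],$$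 with the boundary conditions $$g_0(k|\mathbf{x})=\sum_{\boldsymbol{\xi}\in\mathcal{X}}\mathbb{E}[c^{\mathrm{power}}_{-1}(q_{-1}(\mathbf{X}_{-1}))\mid\mathbf{X}_0=\boldsymbol{\xi}]\Pr[\mathbf{X}_0=\boldsymbol{\xi}\mid\mathbf{X}_1=\mathbf{x}],$$ $$g_d(0|\mathbf{x})=\sum_{i=0}^d\sum_{\boldsymbol{\xi}\in\mathcal{X}}\mathbb{E}[c^{\mathrm{power}}_{i-1}(q_{i-1}(\mathbf{X}_{i-1}))\mid\mathbf{X}_i=\boldsymbol{\xi}]\,\mathbf{P}^{i+1}_{\mathbf{x},\boldsymbol{\xi}},$$ for all $\mathbf{x}\in\mathcal{X}$, $k\ge1$ and $d\ge1$.
   Context: Days are $t=1,\dots,T$. $u_t=1$ is the decision, taken at day $t$, to call a CPP event for day $t+1$, and $u_t=0$ is the decision not to. $M$ is the maximum number of CPP events, and $k$ is the number of the $M$ CPP events that can still be called. $\mathbf{X}_t\in\mathcal{X}\subset\mathbb{R}^n$ is the vector collecting the weather and day of the week at time $t$; it is a finite-state Markov process with state space $\mathcal{X}$ and known transition probabilities. $\mathbf{P}^{i+1}_{\mathbf{x},\boldsymbol{\xi}}$ is the $(i+1)$-step transition probability from $\mathbf{x}$ to $\boldsymbol{\xi}$. The decision $u_t$ is based on the observation of $\mathbf{X}_t$. $q_t:\mathbb{R}^n\to\mathbb{R}$ maps observations to an estimated peak demand level. The cost of supplying power is the quadratic function of the demand $c^{\mathrm{power}}_t(z)=B_tz^2+C_tz+D_t$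 with $B_t\ge0$, $C_t\ge0$, $D_t\ge0$. $y>0$ is the load curtailed during a CPP event, assumed constant and known. $\overline{a}_t\in\mathbb{R}$ is the revenue loss due to high prices. Indexing: in the policy and in the definition of $g$, all subscripts count remaining days $d=T-t$; thus $d=0$ is day $T$, subscript $-1$ is day $T+1$, and $d-1$ is the day after $d$.
   Formalization: P^{i+1} in g_d(0|x) becomes P^{d-i+1}; B_t>0 is assumed for t=2..T; g_0(k|x), k≥1, takes the minimum too (g_{-1}=0, day T compares one-day costs), or is kept as printed if u_T=0 is imposed or an event called on day T never lowers expected cost. *)

theory Defs
  imports "HOL-Probability.Probability"
begin

text \<open>
  Everything given as data (\<open>X\<close>, \<open>q\<close>, \<open>B\<close>, \<open>C\<close>, \<open>D\<close>, \<open>abar\<close>, \<open>P\<close>) is indexed by the calendar day.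
  In \<open>g\<close>, \<open>E_full\<close>, \<open>E_curt\<close> and \<open>calls\<close> the argument \<open>d\<close> counts remaining days: \<open>d\<close> is day \<open>T - d\<close>,
  hence \<open>d - 1\<close> is day \<open>T - d + 1\<close> and \<open>-1\<close> is day \<open>T + 1\<close>. Only \<open>d < T\<close> is meaningful for \<open>calls\<close>
  and \<open>d + 1 < T\<close> for \<open>g\<close>; the truncated subtraction is harmless there.

  \<open>P t x \<xi>\<close> is the transition probability from \<open>x\<close> on day \<open>t\<close> to \<open>\<xi>\<close> on day \<open>t + 1\<close>; it may depend on
  the day (the homogeneous case is a constant \<open>P\<close>). It is defined on all of \<open>S\<close>, also at states
  that are reached with probability 0, where the conditional probabilities of \<open>X\<close> are undefined.
\<close>

locale cpp_problem = prob_space W for W :: "'w measure" +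
  fixes T M :: nat
    and S :: "(real ^ 'n) set"
    and X :: "nat \<Rightarrow> 'w \<Rightarrow> real ^ 'n"
    and P :: "nat \<Rightarrow> real ^ 'n \<Rightarrow> real ^ 'n \<Rightarrow> real"
    and q :: "nat \<Rightarrow> real ^ 'n \<Rightarrow> real"
    and B C D abar :: "nat \<Rightarrow> real"
    and y :: real
  assumes T_pos: "T \<ge> 1"
    and finite_S: "finite S"
    and X_measurable: "\<And>t. t \<in> {1..T+1} \<Longrightarrow> X t \<in> W \<rightarrow>\<^sub>M count_space S"
    and P_nonneg: "\<And>t x \<xi>. t \<in> {1..T} \<Longrightarrow> x \<in> S \<Longrightarrow> \<xi> \<in> S \<Longrightarrow> P t x \<xi> \<ge> 0"
    and P_sum: "\<And>t x. t \<in> {1..T} \<Longrightarrow> x \<in> S \<Longrightarrow> (\<Sum>\<xi>\<in>S. P t x \<xi>) = 1"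
    and markov: "\<And>t x \<xi>. t \<in> {1..T} \<Longrightarrow> (\<And>s. s \<in> {1..t} \<Longrightarrow> x s \<in> S) \<Longrightarrow> \<xi> \<in> S \<Longrightarrow>
        prob {\<omega> \<in> space W. \<forall>s\<in>{1..t}. X s \<omega> = x s} > 0 \<Longrightarrow>
        cond_prob W (\<lambda>\<omega>. X (t+1) \<omega> = \<xi>) (\<lambda>\<omega>. \<forall>s\<in>{1..t}. X s \<omega> = x s) = P t (x t) \<xi>"
    and B_nonneg: "\<And>t. t \<in> {2..T+1} \<Longrightarrow> B t \<ge> 0"
    and C_nonneg: "\<And>t. t \<in> {2..T+1} \<Longrightarrow> C t \<ge> 0"
    and D_nonneg: "\<And>t. t \<in> {2..T+1} \<Longrightarrow> D t \<ge> 0"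
    and y_pos: "y > 0"
begin

definition c_power :: "nat \<Rightarrow> real \<Rightarrow> real" where
  "c_power t z = B t * z\<^sup>2 + C t * z + D t"

text \<open>
  A control assigns to every day and outcome a decision. Decisions on day \<open>t\<close> may use all
  observations up to day \<open>t\<close> (so that in particular they may use the number of remaining events).
  If \<open>open_T\<close> is false, no event may be called on day \<open>T\<close>; if it is true, this is the problem with
  the constraints \<open>u t \<in> {0,1}\<close>, \<open>\<Sum>u t \<le> M\<close> only.
\<close>

definition adapted :: "(nat \<Rightarrow> 'w \<Rightarrow> nat) \<Rightarrow> bool" where
  "adapted u \<longleftrightarrow> (\<forall>t\<in>{1..T}. \<exists>\<phi>. \<forall>\<omega>\<in>space W. u t \<omega> = \<phi> (restrict (\<lambda>s. X s \<omega>) {1..t}))"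

definition feasible :: "bool \<Rightarrow> (nat \<Rightarrow> 'w \<Rightarrow> nat) \<Rightarrow> bool" where
  "feasible open_T u \<longleftrightarrow> adapted u \<and>
     (\<forall>\<omega>\<in>space W. (\<forall>t\<in>{1..T}. u t \<omega> \<in> {0, 1}) \<and> (\<Sum>t=1..T. u t \<omega>) \<le> M \<and> (open_T \<or> u T \<omega> = 0))"

definition expected_cost :: "(nat \<Rightarrow> 'w \<Rightarrow> nat) \<Rightarrow> real" where
  "expected_cost u = expectation (\<lambda>\<omega>. \<Sum>t=1..T.
      c_power (t+1) (q (t+1) (X (t+1) \<omega>)) * (1 - real (u t \<omega>))
    + c_power (t+1) (q (t+1) (X (t+1) \<omega>) - y) * real (u t \<omega>)
    + abar (t+1) * real (u t \<omega>))"

definition optimal :: "bool \<Rightarrow> (nat \<Rightarrow> 'w \<Rightarrow> nat) \<Rightarrow> bool" where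
  "optimal open_T u \<longleftrightarrow> feasible open_T u \<and> (\<forall>v. feasible open_T v \<longrightarrow> expected_cost u \<le> expected_cost v)"

text \<open>\<open>E_next t f x\<close> is the conditional expectation of \<open>f (X (t+1))\<close> given \<open>X t = x\<close>.\<close>

definition E_next :: "nat \<Rightarrow> (real ^ 'n \<Rightarrow> real) \<Rightarrow> real ^ 'n \<Rightarrow> real" where
  "E_next t f x = (\<Sum>\<xi>\<in>S. f \<xi> * P t x \<xi>)"

text \<open>\<open>P_steps t m x \<xi>\<close> is the \<open>m\<close>-step transition probability from \<open>x\<close> on day \<open>t\<close>.\<close>

primrec P_steps :: "nat \<Rightarrow> nat \<Rightarrow> real ^ 'n \<Rightarrow> real ^ 'n \<Rightarrow> real" where
  "P_steps t 0 x \<xi> = of_bool (x = \<xi>)"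
| "P_steps t (Suc m) x \<xi> = (\<Sum>z\<in>S. P_steps t m x z * P (t + m) z \<xi>)"

text \<open>Expected power cost of the day after \<open>d\<close> given the state on day \<open>d\<close>, without and with an event.\<close>

definition E_full :: "nat \<Rightarrow> real ^ 'n \<Rightarrow> real" where
  "E_full d \<xi> = E_next (T - d) (\<lambda>z. c_power (T - d + 1) (q (T - d + 1) z)) \<xi>"

definition E_curt :: "nat \<Rightarrow> real ^ 'n \<Rightarrow> real" where
  "E_curt d \<xi> = E_next (T - d) (\<lambda>z. c_power (T - d + 1) (q (T - d + 1) z - y)) \<xi>"

text \<open>
  \<open>g open_T d k x\<close> is the optimal expected cost from day \<open>d\<close> on, given state \<open>x\<close> on day \<open>d + 1\<close> and \<open>k\<close>
  remaining events. The boundary values at \<open>d = 0\<close> for \<open>open_T = False\<close> charge the power cost of day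
  \<open>T + 1\<close> without an event, whatever \<open>k\<close> is; this is the dynamic programming value only if no event
  is called on day \<open>T\<close>. With \<open>open_T = True\<close> the minimum is also taken at \<open>d = 0\<close>.
  In the value for \<open>k = 0\<close>, \<open>X\<close> moves from day \<open>d + 1\<close> to day \<open>i\<close> (both counted in remaining days),
  which takes \<open>d - i + 1\<close> steps.
\<close>

fun g :: "bool \<Rightarrow> nat \<Rightarrow> nat \<Rightarrow> real ^ 'n \<Rightarrow> real" where
  "g open_T 0 k x = (\<Sum>\<xi>\<in>S.
      (if open_T \<and> k \<ge> 1 then min (E_full 0 \<xi>) (abar (T + 1) + E_curt 0 \<xi>) else E_full 0 \<xi>)
      * P (T - 1) x \<xi>)"
| "g open_T (Suc d) 0 x =
      (\<Sum>i=0..Suc d. \<Sum>\<xi>\<in>S. E_full i \<xi> * P_steps (T - (Suc d + 1)) (Suc d - i + 1) x \<xi>)"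
| "g open_T (Suc d) (Suc k) x = (\<Sum>\<xi>\<in>S.
      min (g open_T d (Suc k) \<xi> + E_full (Suc d) \<xi>)
          (g open_T d k \<xi> + abar (T - Suc d + 1) + E_curt (Suc d) \<xi>)
      * P (T - (Suc d + 1)) x \<xi>)"

text \<open>
  \<open>calls open_T d k x\<close>: an event is called on day \<open>d\<close> in state \<open>x\<close> with \<open>k\<close> remaining events. The
  threshold rule concerns \<open>d \<ge> 1\<close>; on day \<open>T\<close> nothing remains to be compared but the two one-day
  expected costs.
\<close>

definition calls :: "bool \<Rightarrow> nat \<Rightarrow> nat \<Rightarrow> real ^ 'n \<Rightarrow> bool" where
  "calls open_T d k x \<longleftrightarrow> k \<ge> 1 \<and>
    (if d = 0 then open_T \<and> E_full 0 x > abar (T + 1) + E_curt 0 x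
     else E_next (T - d) (q (T - d + 1)) x >
       1 / (2 * y * B (T - d + 1)) *
       (g open_T (d - 1) (k - 1) x - g open_T (d - 1) k x
        + abar (T - d + 1) - C (T - d + 1) * y + B (T - d + 1) * y\<^sup>2))"

text \<open>Decision on calendar day \<open>t\<close> along the trajectory \<open>x\<close>, and the resulting control.\<close>

fun decision :: "bool \<Rightarrow> (nat \<Rightarrow> real ^ 'n) \<Rightarrow> nat \<Rightarrow> nat" where
  "decision open_T x t = of_bool (calls open_T (T - t) (M - (\<Sum>s\<in>{1..<t}. decision open_T x s)) (x t))"

definition cpp_policy :: "bool \<Rightarrow> nat \<Rightarrow> 'w \<Rightarrow> nat" where
  "cpp_policy open_T t \<omega> = decision open_T (\<lambda>s. X s \<omega>) t"

end

end

theory Submission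
  imports Defs
begin

text \<open>
  The proof is a verification argument. \<open>best open_T d k x\<close> is the Bellman value on day \<open>d\<close> in state
  \<open>x\<close>: the cheaper of the permitted decisions when everything that follows is charged by \<open>g\<close>. Three
  facts carry the theorem.

  The threshold rule is the comparison of these two decisions (\<open>calls_iff_cheaper\<close>). The cost of
  power is quadratic, so curtailing a constant \<open>y\<close> saves an amount that is affine in the demand; only
  the conditional mean of the demand enters the comparison, with coefficient \<open>2 * y * B\<close>. On the days
  of the threshold rule this coefficient is positive, and dividing by it gives the stated threshold.

  The function \<open>g\<close> is the conditional expectation of \<open>best\<close> one day ahead (\<open>g_eq_average_best\<close>). For
  \<open>k \<ge> 1\<close> this is its recursion; for \<open>k = 0\<close> it is the equation of Chapman and Kolmogorov, applied to
  the closed form.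

  Finally, fix a feasible control \<open>u\<close> and charge day \<open>t\<close> with \<open>best\<close> at the current state and the
  current number of remaining events. By the Markov property (\<open>expectation_next_state\<close>), the expected
  cost of day \<open>t\<close> plus the expected value on day \<open>t + 1\<close> is the expected \<open>action_cost\<close> of the decision
  taken, which is at least the value on day \<open>t\<close>. Summing over the days telescopes: the cost of \<open>u\<close> is
  the value on day 1, which does not depend on \<open>u\<close>, plus the expected losses of the single decisions
  (\<open>expected_cost_telescope\<close>). The losses are nonnegative for every feasible control and zero for the
  threshold policy.

  For the second claim, if an event on day \<open>T\<close> is nowhere cheaper than none, then the two versions of
  \<open>g\<close> coincide and so do the decisions of the two policies on every outcome.
\<close>

context cpp_problem
begin

section \<open>One-step expectations and the threshold\<close>

lemma E_next_add: "E_next t (\<lambda>z. f z + h z) x = E_next t f x + E_next t h x"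
  by (simp add: E_next_def sum.distrib algebra_simps)

lemma E_next_cmult: "E_next t (\<lambda>z. a * f z) x = a * E_next t f x"
  by (simp add: E_next_def sum_distrib_left mult.assoc)

lemma E_next_const:
  assumes "t \<in> {1..T}" "x \<in> S"
  shows "E_next t (\<lambda>_. a) x = a"
  using P_sum[OF assms] by (simp add: E_next_def flip: sum_distrib_left)

lemma E_next_cong:
  assumes "\<And>z. z \<in> S \<Longrightarrow> f z = h z"
  shows "E_next t f x = E_next t h x"
  using assms by (simp add: E_next_def)

text \<open>
  The quadratic terms cancel: \<open>z\<^sup>2 - (z - y)\<^sup>2 = 2 * y * z - y\<^sup>2\<close>. Hence the saving depends on the law
  of the demand only through its mean.
\<close>
lemma curtailment_saving:
  assumes "t \<in> {1..T}" "x \<in> S"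
  shows "E_next t (\<lambda>z. c_power s (q s z)) x - E_next t (\<lambda>z. c_power s (q s z - y)) x
       = 2 * y * B s * E_next t (q s) x - B s * y\<^sup>2 + C s * y"
proof -
  have "E_next t (\<lambda>z. c_power s (q s z)) x
      = E_next t (\<lambda>z. c_power s (q s z - y) + (2 * y * B s * q s z + (C s * y - B s * y\<^sup>2))) x"
    by (rule E_next_cong) (simp add: c_power_def power2_eq_square algebra_simps)
  then show ?thesis
    by (simp add: E_next_add E_next_cmult E_next_const[OF assms])
qed

text \<open>
  Optimal expected cost from day \<open>d - 1\<close> on, given the state on day \<open>d\<close>. Nothing follows after
  \<open>d = 0\<close>, since the power cost of day \<open>T + 1\<close> is charged to the decision on day \<open>T\<close>.
\<close>
definition future :: "bool \<Rightarrow> nat \<Rightarrow> nat \<Rightarrow> real ^ 'n \<Rightarrow> real" where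
  "future open_T d k x = (case d of 0 \<Rightarrow> 0 | Suc d' \<Rightarrow> g open_T d' k x)"

definition action_cost :: "bool \<Rightarrow> nat \<Rightarrow> nat \<Rightarrow> real ^ 'n \<Rightarrow> nat \<Rightarrow> real" where
  "action_cost open_T d k x a =
     (if a = 0 then E_full d x + future open_T d k x
      else abar (T - d + 1) + E_curt d x + future open_T d (k - 1) x)"

definition best :: "bool \<Rightarrow> nat \<Rightarrow> nat \<Rightarrow> real ^ 'n \<Rightarrow> real" where
  "best open_T d k x =
     (if k \<ge> 1 \<and> (d \<ge> 1 \<or> open_T)
      then min (action_cost open_T d k x 0) (action_cost open_T d k x 1)
      else action_cost open_T d k x 0)"

text \<open>
  The threshold is the solution, for the mean demand, of the inequality saying that an event is
  strictly cheaper; \<open>B > 0\<close> is what permits dividing. At \<open>d = 0\<close> the rule is already stated as a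
  comparison of costs.
\<close>
lemma calls_iff_cheaper:
  assumes "d < T" "x \<in> S" and B: "\<And>t. t \<in> {2..T} \<Longrightarrow> B t > 0"
  shows "calls open_T d k x \<longleftrightarrow> k \<ge> 1 \<and> (d \<ge> 1 \<or> open_T)
           \<and> action_cost open_T d k x 1 < action_cost open_T d k x 0"
proof (cases d)
  case 0
  then show ?thesis by (auto simp: calls_def action_cost_def future_def)
next
  case (Suc d')
  let ?s = "T - d + 1"
  have Bs: "B ?s > 0" using assms(1) Suc by (intro B) auto
  have t: "T - d \<in> {1..T}" using assms(1) by auto
  have saving: "E_full d x - E_curt d x
      = 2 * y * B ?s * E_next (T - d) (q ?s) x - B ?s * y\<^sup>2 + C ?s * y"
    using curtailment_saving[OF t assms(2)] by (simp add: E_full_def E_curt_def)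
  have pos: "2 * y * B ?s > 0" using Bs y_pos by simp
  have div: "1 / c * r < e \<longleftrightarrow> r < c * e" if "c > 0" for c r e :: real
    using that by (simp add: field_simps)
  show ?thesis
    unfolding calls_def div[OF pos] using Suc saving
    by (auto simp: action_cost_def future_def)
qed

lemma best_eq_calls:
  assumes "d < T" "x \<in> S" "\<And>t. t \<in> {2..T} \<Longrightarrow> B t > 0"
  shows "best open_T d k x = action_cost open_T d k x (of_bool (calls open_T d k x))"
  using calls_iff_cheaper[OF assms] by (auto simp: best_def)

lemma best_le_action_cost:
  assumes "a \<in> {0, 1}" "a = 1 \<Longrightarrow> k \<ge> 1 \<and> (d \<ge> 1 \<or> open_T)"
  shows "best open_T d k x \<le> action_cost open_T d k x a"
  using assms by (auto simp: best_def)


section \<open>The recursion for \<open>g\<close> as a Bellman equation\<close>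

lemma P_steps_one: "x \<in> S \<Longrightarrow> P_steps t (Suc 0) x \<xi> = P t x \<xi>"
proof -
  assume "x \<in> S"
  moreover have "P_steps t (Suc 0) x \<xi> = (\<Sum>z\<in>S. if x = z then P t z \<xi> else 0)"
    by (auto intro!: sum.cong)
  ultimately show ?thesis using finite_S by simp
qed

text \<open>
  \<open>P_steps\<close> splits off the last step, whereas the Bellman equation conditions on the first one. Both
  decompositions agree by associativity of the product of transition matrices.
\<close>
lemma P_steps_first_step:
  assumes "x \<in> S"
  shows "P_steps t (Suc (Suc m)) x \<xi> = (\<Sum>z\<in>S. P t x z * P_steps (Suc t) (Suc m) z \<xi>)"
proof (induction m arbitrary: \<xi>)
  case 0
  show ?case
    unfolding P_steps.simps(2)[of t "Suc 0"]
    by (rule sum.cong) (simp_all add: P_steps_one assms del: P_steps.simps)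
next
  case (Suc m)
  have "P_steps t (Suc (Suc (Suc m))) x \<xi>
      = (\<Sum>w\<in>S. (\<Sum>z\<in>S. P t x z * P_steps (Suc t) (Suc m) z w) * P (t + Suc (Suc m)) w \<xi>)"
    unfolding P_steps.simps(2)[of t "Suc (Suc m)"] Suc.IH ..
  also have "\<dots> = (\<Sum>w\<in>S. \<Sum>z\<in>S. P t x z * (P_steps (Suc t) (Suc m) z w * P (t + Suc (Suc m)) w \<xi>))"
    by (simp add: sum_distrib_right mult.assoc del: P_steps.simps)
  also have "\<dots> = (\<Sum>z\<in>S. P t x z * (\<Sum>w\<in>S. P_steps (Suc t) (Suc m) z w * P (t + Suc (Suc m)) w \<xi>))"
    by (subst sum.swap) (simp add: sum_distrib_left del: P_steps.simps)
  also have "\<dots> = (\<Sum>z\<in>S. P t x z * P_steps (Suc t) (Suc (Suc m)) z \<xi>)"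
    unfolding P_steps.simps(2)[of "Suc t" "Suc m"] by simp
  finally show ?case .
qed

text \<open>
  At \<open>k = 0\<close> the base case \<open>d = 0\<close> of \<open>g\<close> is the instance of the closed form with a single summand, so
  that the recursion below can treat all \<open>d\<close> alike.
\<close>
lemma g_no_events:
  assumes "x \<in> S"
  shows "g open_T d 0 x
       = (\<Sum>i=0..d. \<Sum>\<xi>\<in>S. E_full i \<xi> * P_steps (T - (d + 1)) (Suc (d - i)) x \<xi>)"
proof (cases d)
  case 0
  then show ?thesis by (simp add: P_steps_one[OF assms] del: P_steps.simps)
next
  case (Suc d')
  then show ?thesis by (simp del: P_steps.simps)
qed

text \<open>
  In the closed form, the summand \<open>i = Suc d\<close> is the cost of the first day reached. Splitting off the
  first transition in the others gives the closed form one day later.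
\<close>
lemma g_no_events_rec:
  assumes "Suc d + 1 < T" "x \<in> S"
  shows "g open_T (Suc d) 0 x
       = (\<Sum>z\<in>S. (E_full (Suc d) z + g open_T d 0 z) * P (T - (Suc d + 1)) x z)"
proof -
  let ?t = "T - (Suc d + 1)"
  have t: "T - Suc d = Suc (T - Suc (Suc d))" using assms(1) by simp
  have first: "(\<Sum>\<xi>\<in>S. E_full i \<xi> * P_steps ?t (Suc (Suc d - i)) x \<xi>)
      = (\<Sum>z\<in>S. (\<Sum>\<xi>\<in>S. E_full i \<xi> * P_steps (Suc ?t) (Suc (d - i)) z \<xi>) * P ?t x z)"
    if "i \<le> d" for i
  proof -
    have "(\<Sum>\<xi>\<in>S. E_full i \<xi> * P_steps ?t (Suc (Suc d - i)) x \<xi>)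
        = (\<Sum>\<xi>\<in>S. \<Sum>z\<in>S. E_full i \<xi> * P_steps (Suc ?t) (Suc (d - i)) z \<xi> * P ?t x z)"
      unfolding Suc_diff_le[OF that] P_steps_first_step[OF assms(2)]
      by (simp add: sum_distrib_left mult_ac del: P_steps.simps)
    also have "\<dots> = (\<Sum>z\<in>S. (\<Sum>\<xi>\<in>S. E_full i \<xi> * P_steps (Suc ?t) (Suc (d - i)) z \<xi>) * P ?t x z)"
      by (subst sum.swap) (simp add: sum_distrib_right del: P_steps.simps)
    finally show ?thesis .
  qed
  have "g open_T (Suc d) 0 x
      = (\<Sum>i=0..d. \<Sum>\<xi>\<in>S. E_full i \<xi> * P_steps ?t (Suc (Suc d - i)) x \<xi>)
        + (\<Sum>\<xi>\<in>S. E_full (Suc d) \<xi> * P_steps ?t (Suc 0) x \<xi>)"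
    unfolding g_no_events[OF assms(2)] by (simp del: P_steps.simps)
  also have "(\<Sum>i=0..d. \<Sum>\<xi>\<in>S. E_full i \<xi> * P_steps ?t (Suc (Suc d - i)) x \<xi>)
      = (\<Sum>i=0..d. \<Sum>z\<in>S. (\<Sum>\<xi>\<in>S. E_full i \<xi> * P_steps (Suc ?t) (Suc (d - i)) z \<xi>) * P ?t x z)"
    by (rule sum.cong[OF refl], rule first) simp
  also have "\<dots> = (\<Sum>z\<in>S. g open_T d 0 z * P ?t x z)"
    by (subst sum.swap, rule sum.cong[OF refl])
       (simp add: g_no_events t sum_distrib_right del: P_steps.simps)
  finally show ?thesis
    by (simp add: P_steps_one[OF assms(2)] sum.distrib algebra_simps del: P_steps.simps g.simps)
qed

lemma g_eq_average_best:
  assumes "d + 1 < T" "x \<in> S"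
  shows "g open_T d k x = E_next (T - (d + 1)) (best open_T d k) x"
proof (cases d)
  case 0
  then show ?thesis
    by (auto simp: E_next_def best_def action_cost_def future_def intro!: sum.cong)
next
  case (Suc d')
  show ?thesis
  proof (cases k)
    case 0
    then show ?thesis using Suc g_no_events_rec[of d' x open_T] assms
      by (simp add: E_next_def best_def action_cost_def future_def del: g.simps)
  next
    case (Suc k')
    then show ?thesis using \<open>d = Suc d'\<close>
      by (simp add: E_next_def best_def action_cost_def future_def add_ac)
  qed
qed

definition stage_cost :: "nat \<Rightarrow> nat \<Rightarrow> real ^ 'n \<Rightarrow> real" where
  "stage_cost t a z = c_power (t+1) (q (t+1) z) * (1 - real a)
     + c_power (t+1) (q (t+1) z - y) * real a + abar (t+1) * real a"

text \<open>
  \<open>best\<close> by calendar day, with the value 0 on day \<open>T + 1\<close> so that the telescoping sum below needs no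
  separate last day.
\<close>
definition value_at :: "bool \<Rightarrow> nat \<Rightarrow> nat \<Rightarrow> real ^ 'n \<Rightarrow> real" where
  "value_at open_T t k x = (if t \<le> T then best open_T (T - t) k x else 0)"

lemma E_next_stage_plus_value:
  assumes t: "t \<in> {1..T}" and x: "x \<in> S" and a: "a \<in> {0, 1}"
  shows "E_next t (\<lambda>z. stage_cost t a z + value_at open_T (t + 1) (k - a) z) x
       = action_cost open_T (T - t) k x a"
proof -
  have fut: "E_next t (value_at open_T (t + 1) k') x = future open_T (T - t) k' x" for k'
  proof (cases "t = T")
    case True
    then show ?thesis by (simp add: value_at_def E_next_def future_def)
  next
    case False
    then obtain d where d: "T - t = Suc d" and "t = T - (d + 1)" and "T - (t + 1) = d"
      using t by (metis Suc_diff_Suc Suc_eq_plus1 atLeastAtMost_iff diff_diff_cancel le_neq_implies_less)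
    have "value_at open_T (t + 1) k' = best open_T d k'"
      using d \<open>T - (t + 1) = d\<close> by (auto simp: value_at_def fun_eq_iff)
    moreover have "d + 1 < T" using d t by auto
    ultimately show ?thesis
      using g_eq_average_best[OF _ x] d \<open>t = T - (d + 1)\<close> by (simp add: future_def del: g.simps)
  qed
  have "T - (T - t) = t" using t by simp
  then have "E_next t (stage_cost t a) x
      = (if a = 0 then E_full (T - t) x else abar (t + 1) + E_curt (T - t) x)"
    using a by (auto simp: stage_cost_def[abs_def] E_full_def E_curt_def E_next_add E_next_const[OF t x])
  then show ?thesis using a \<open>T - (T - t) = t\<close> fut[of k] fut[of "k - 1"]
    by (auto simp: E_next_add action_cost_def)
qed


section \<open>Observed histories\<close>

definition history :: "nat \<Rightarrow> 'w \<Rightarrow> nat \<Rightarrow> real ^ 'n" where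
  "history t \<omega> = restrict (\<lambda>s. X s \<omega>) {1..t}"

lemma X_in_S: "t \<in> {1..T+1} \<Longrightarrow> \<omega> \<in> space W \<Longrightarrow> X t \<omega> \<in> S"
  using measurable_space[OF X_measurable] by auto

lemma X_event:
  assumes "t \<in> {1..T+1}"
  shows "{\<omega> \<in> space W. X t \<omega> = \<xi>} \<in> events"
proof -
  have "{\<omega> \<in> space W. X t \<omega> = \<xi>} = X t -` ({\<xi>} \<inter> S) \<inter> space W"
    using X_in_S[OF assms] by auto
  also have "\<dots> \<in> events"
    by (rule measurable_sets[OF X_measurable[OF assms]]) simp
  finally show ?thesis .
qed

lemma path_event:
  assumes "t \<le> T + 1"
  shows "{\<omega> \<in> space W. \<forall>s\<in>{1..t}. X s \<omega> = h s} \<in> events"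
  using assms by (intro sets.sets_Collect_finite_All) (auto intro: X_event)

lemma history_in_paths:
  "t \<le> T + 1 \<Longrightarrow> \<omega> \<in> space W \<Longrightarrow> history t \<omega> \<in> {1..t} \<rightarrow>\<^sub>E S"
  by (auto simp: history_def intro: X_in_S)

lemma history_eq_iff:
  "h \<in> {1..t} \<rightarrow>\<^sub>E S \<Longrightarrow> history t \<omega> = h \<longleftrightarrow> (\<forall>s\<in>{1..t}. X s \<omega> = h s)"
  by (auto simp: history_def fun_eq_iff restrict_def PiE_def extensional_def)

text \<open>
  States are finite in number, hence so are histories; all expectations below are finite sums over
  histories, and integrability is automatic whatever function of the history a control uses.
\<close>
lemma finite_range_expectation:
  fixes F :: "'c \<Rightarrow> real"
  assumes R: "finite R" "\<And>\<omega>. \<omega> \<in> space W \<Longrightarrow> Z \<omega> \<in> R"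
    and ev: "\<And>z. z \<in> R \<Longrightarrow> {\<omega> \<in> space W. Z \<omega> = z} \<in> events"
  shows "integrable W (\<lambda>\<omega>. F (Z \<omega>))"
    and "expectation (\<lambda>\<omega>. F (Z \<omega>)) = (\<Sum>z\<in>R. F z * prob {\<omega> \<in> space W. Z \<omega> = z})"
proof -
  have eq: "F (Z \<omega>) = (\<Sum>z\<in>R. F z * indicator {\<omega> \<in> space W. Z \<omega> = z} \<omega>)"
    if "\<omega> \<in> space W" for \<omega>
  proof -
    have "(\<Sum>z\<in>R. F z * indicator {\<omega> \<in> space W. Z \<omega> = z} \<omega>) = (\<Sum>z\<in>R. if z = Z \<omega> then F z else 0)"
      using that by (intro sum.cong) (auto simp: indicator_def)
    then show ?thesis using R that by simp
  qed
  have int: "integrable W (\<lambda>\<omega>. F z * indicator {\<omega> \<in> space W. Z \<omega> = z} \<omega>)" if "z \<in> R" for z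
    using ev[OF that] by (intro integrable_mult_right integrable_real_indicator) (auto simp: emeasure_eq_measure)
  show "integrable W (\<lambda>\<omega>. F (Z \<omega>))"
    by (subst Bochner_Integration.integrable_cong[OF refl eq]) (auto intro: int)
  show "expectation (\<lambda>\<omega>. F (Z \<omega>)) = (\<Sum>z\<in>R. F z * prob {\<omega> \<in> space W. Z \<omega> = z})"
  proof -
    have "expectation (\<lambda>\<omega>. F (Z \<omega>))
        = expectation (\<lambda>\<omega>. \<Sum>z\<in>R. F z * indicator {\<omega> \<in> space W. Z \<omega> = z} \<omega>)"
      by (rule Bochner_Integration.integral_cong[OF refl eq])
    also have "\<dots> = (\<Sum>z\<in>R. expectation (\<lambda>\<omega>. F z * indicator {\<omega> \<in> space W. Z \<omega> = z} \<omega>))"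
      by (rule Bochner_Integration.integral_sum[OF int])
    also have "\<dots> = (\<Sum>z\<in>R. F z * prob {\<omega> \<in> space W. Z \<omega> = z})"
      using ev by (intro sum.cong) (simp_all add: Int_absorb2)
    finally show ?thesis .
  qed
qed

lemma history_expectation:
  fixes F :: "(nat \<Rightarrow> real ^ 'n) \<Rightarrow> real"
  assumes "t \<le> T + 1"
  shows "integrable W (\<lambda>\<omega>. F (history t \<omega>))"
    and "expectation (\<lambda>\<omega>. F (history t \<omega>))
       = (\<Sum>h\<in>{1..t} \<rightarrow>\<^sub>E S. F h * prob {\<omega> \<in> space W. history t \<omega> = h})"
proof -
  have fin: "finite ({1..t} \<rightarrow>\<^sub>E S)" using finite_S by (intro finite_PiE) auto
  have ev: "{\<omega> \<in> space W. history t \<omega> = h} \<in> events" if "h \<in> {1..t} \<rightarrow>\<^sub>E S" for h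
    using path_event[OF assms] by (simp add: history_eq_iff[OF that])
  show "integrable W (\<lambda>\<omega>. F (history t \<omega>))"
    and "expectation (\<lambda>\<omega>. F (history t \<omega>))
       = (\<Sum>h\<in>{1..t} \<rightarrow>\<^sub>E S. F h * prob {\<omega> \<in> space W. history t \<omega> = h})"
    using finite_range_expectation[OF fin history_in_paths[OF assms] ev, of F] by auto
qed

text \<open>
  The Markov property in product form. It also holds for histories of probability 0, where the
  conditional probability says nothing, because then both sides vanish.
\<close>
lemma prob_history_next:
  assumes t: "t \<in> {1..T}" and h: "h \<in> {1..t} \<rightarrow>\<^sub>E S" and \<xi>: "\<xi> \<in> S"
  shows "prob {\<omega> \<in> space W. history t \<omega> = h \<and> X (t+1) \<omega> = \<xi>}
       = P t (h t) \<xi> * prob {\<omega> \<in> space W. history t \<omega> = h}"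
proof -
  let ?A = "{\<omega> \<in> space W. history t \<omega> = h}"
  let ?B = "{\<omega> \<in> space W. history t \<omega> = h \<and> X (t+1) \<omega> = \<xi>}"
  have A: "?A \<in> events"
    using path_event[of t h] t by (simp add: history_eq_iff[OF h])
  show ?thesis
  proof (cases "prob ?A > 0")
    case True
    then have "cond_prob W (\<lambda>\<omega>. X (t+1) \<omega> = \<xi>) (\<lambda>\<omega>. history t \<omega> = h) = P t (h t) \<xi>"
      using markov[OF t PiE_mem[OF h] \<xi>] by (simp add: history_eq_iff[OF h])
    then show ?thesis using True by (simp add: cond_prob_def field_simps conj_commute)
  next
    case False
    then have "prob ?A = 0" by (simp add: zero_less_measure_iff)
    moreover have "prob ?B \<le> prob ?A"
      using A by (intro finite_measure_mono) auto
    ultimately have "prob ?B = 0" using measure_nonneg[of W ?B] by linarith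
    then show ?thesis using \<open>prob ?A = 0\<close> by simp
  qed
qed

text \<open>
  The Markov property for functions of the history and the next state. The dependence of \<open>f\<close> on the
  whole history is needed because a control and its number of remaining events may depend on it.
\<close>
lemma expectation_next_state:
  fixes f :: "(nat \<Rightarrow> real ^ 'n) \<Rightarrow> real ^ 'n \<Rightarrow> real"
  assumes t: "t \<in> {1..T}"
  shows "integrable W (\<lambda>\<omega>. f (history t \<omega>) (X (t+1) \<omega>))"
    and "expectation (\<lambda>\<omega>. f (history t \<omega>) (X (t+1) \<omega>))
       = expectation (\<lambda>\<omega>. E_next t (f (history t \<omega>)) (X t \<omega>))"
proof -
  let ?R = "({1..t} \<rightarrow>\<^sub>E S) \<times> S"
  let ?Z = "\<lambda>\<omega>. (history t \<omega>, X (t+1) \<omega>)"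
  have t': "t \<le> T + 1" using t by auto
  have "finite ({1..t} \<rightarrow>\<^sub>E S)" using finite_S by (intro finite_PiE) auto
  then have fin: "finite ?R" using finite_S by simp
  have in_R: "?Z \<omega> \<in> ?R" if "\<omega> \<in> space W" for \<omega>
    using history_in_paths[OF t' that] X_in_S[OF _ that, of "t+1"] t by auto
  have ev: "{\<omega> \<in> space W. ?Z \<omega> = z} \<in> events" if z: "z \<in> ?R" for z
  proof -
    have "{\<omega> \<in> space W. ?Z \<omega> = z}
        = {\<omega> \<in> space W. \<forall>s\<in>{1..t}. X s \<omega> = fst z s} \<inter> {\<omega> \<in> space W. X (t+1) \<omega> = snd z}"
      using history_eq_iff[of "fst z" t] z by (auto simp: prod_eq_iff mem_Times_iff)
    then show ?thesis using path_event[OF t'] X_event[of "t+1"] t by auto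
  qed
  note E = finite_range_expectation[OF fin in_R ev, of "\<lambda>(h, \<xi>). f h \<xi>"]
  show "integrable W (\<lambda>\<omega>. f (history t \<omega>) (X (t+1) \<omega>))"
    using E(1) by simp
  have X_hist: "X t \<omega> = history t \<omega> t" for \<omega>
    using t by (simp add: history_def)
  have "expectation (\<lambda>\<omega>. f (history t \<omega>) (X (t+1) \<omega>))
      = (\<Sum>h\<in>{1..t} \<rightarrow>\<^sub>E S. \<Sum>\<xi>\<in>S. f h \<xi> * prob {\<omega> \<in> space W. history t \<omega> = h \<and> X (t+1) \<omega> = \<xi>})"
    using E(2) by (simp add: sum.cartesian_product case_prod_beta prod_eq_iff)
  also have "\<dots> = (\<Sum>h\<in>{1..t} \<rightarrow>\<^sub>E S. E_next t (f h) (h t) * prob {\<omega> \<in> space W. history t \<omega> = h})"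
    using prob_history_next[OF t] by (simp add: E_next_def sum_distrib_right mult.assoc)
  also have "\<dots> = expectation (\<lambda>\<omega>. E_next t (f (history t \<omega>)) (X t \<omega>))"
    unfolding X_hist using history_expectation(2)[OF t', of "\<lambda>h. E_next t (f h) (h t)"] by simp
  finally show "expectation (\<lambda>\<omega>. f (history t \<omega>) (X (t+1) \<omega>))
       = expectation (\<lambda>\<omega>. E_next t (f (history t \<omega>)) (X t \<omega>))" .
qed


section \<open>Optimality from the losses of single decisions\<close>

definition remaining :: "(nat \<Rightarrow> 'w \<Rightarrow> nat) \<Rightarrow> nat \<Rightarrow> 'w \<Rightarrow> nat" where
  "remaining u t \<omega> = M - (\<Sum>s\<in>{1..<t}. u s \<omega>)"

lemma adapted_history:
  assumes "adapted u"
  obtains \<phi> where "\<And>t \<omega>. t \<in> {1..T} \<Longrightarrow> \<omega> \<in> space W \<Longrightarrow> u t \<omega> = \<phi> t (history t \<omega>)"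
  using assms unfolding adapted_def history_def by metis

lemma history_restrict: "s \<le> t \<Longrightarrow> restrict (history t \<omega>) {1..s} = history s \<omega>"
  by (auto simp: history_def fun_eq_iff)

lemma remaining_history:
  assumes "adapted u"
  obtains \<kappa> where "\<And>t \<omega>. t \<in> {1..T+1} \<Longrightarrow> \<omega> \<in> space W \<Longrightarrow> remaining u t \<omega> = \<kappa> t (history t \<omega>)"
proof -
  obtain \<phi> where \<phi>: "\<And>t \<omega>. t \<in> {1..T} \<Longrightarrow> \<omega> \<in> space W \<Longrightarrow> u t \<omega> = \<phi> t (history t \<omega>)"
    using adapted_history[OF assms] by metis
  have "remaining u t \<omega> = M - (\<Sum>s\<in>{1..<t}. \<phi> s (restrict (history t \<omega>) {1..s}))"
    if "t \<in> {1..T+1}" and \<omega>: "\<omega> \<in> space W" for t \<omega>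
  proof -
    have "u s \<omega> = \<phi> s (restrict (history t \<omega>) {1..s})" if "s \<in> {1..<t}" for s
    proof -
      have "s \<in> {1..T}" using that \<open>t \<in> {1..T+1}\<close> by auto
      then show ?thesis using \<phi> \<omega> that history_restrict[of s t \<omega>] by simp
    qed
    then show ?thesis by (simp add: remaining_def)
  qed
  then show thesis
    by (rule that[of "\<lambda>t h. M - (\<Sum>s\<in>{1..<t}. \<phi> s (restrict h {1..s}))"])
qed

text \<open>
  One day of the verification argument: the decision and the number of remaining events are known
  from the history, so that conditioning on it averages over the next state only.
\<close>
lemma one_day:
  assumes u: "feasible open_T u" and t: "t \<in> {1..T}"
  shows "integrable W (\<lambda>\<omega>. value_at open_T t (remaining u t \<omega>) (X t \<omega>))" (is "integrable W ?V")
    and "integrable W (\<lambda>\<omega>. value_at open_T (t+1) (remaining u (t+1) \<omega>) (X (t+1) \<omega>))" (is "integrable W ?V'")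
    and "integrable W (\<lambda>\<omega>. stage_cost t (u t \<omega>) (X (t+1) \<omega>))" (is "integrable W ?c")
    and "integrable W (\<lambda>\<omega>. action_cost open_T (T - t) (remaining u t \<omega>) (X t \<omega>) (u t \<omega>))" (is "integrable W ?a")
    and "expectation (\<lambda>\<omega>. stage_cost t (u t \<omega>) (X (t+1) \<omega>))
       + expectation (\<lambda>\<omega>. value_at open_T (t+1) (remaining u (t+1) \<omega>) (X (t+1) \<omega>))
       = expectation (\<lambda>\<omega>. action_cost open_T (T - t) (remaining u t \<omega>) (X t \<omega>) (u t \<omega>))"
proof -
  have ad: "adapted u" and u01: "\<And>\<omega>. \<omega> \<in> space W \<Longrightarrow> u t \<omega> \<in> {0, 1}"
    using u t by (auto simp: feasible_def)
  obtain \<phi> where \<phi>: "\<And>t \<omega>. t \<in> {1..T} \<Longrightarrow> \<omega> \<in> space W \<Longrightarrow> u t \<omega> = \<phi> t (history t \<omega>)"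
    using adapted_history[OF ad] by metis
  obtain \<kappa> where \<kappa>: "\<And>t \<omega>. t \<in> {1..T+1} \<Longrightarrow> \<omega> \<in> space W \<Longrightarrow> remaining u t \<omega> = \<kappa> t (history t \<omega>)"
    using remaining_history[OF ad] by metis
  have t': "t \<le> T + 1" "t \<in> {1..T+1}" using t by auto
  have X_hist: "X t \<omega> = history t \<omega> t" for \<omega>
    using t by (simp add: history_def)
  have rem: "remaining u (t+1) \<omega> = remaining u t \<omega> - u t \<omega>" for \<omega>
    using t by (simp add: remaining_def)
  note cong = Bochner_Integration.integrable_cong[OF refl, THEN iffD2]
  show "integrable W ?V"
    by (rule cong[OF _ history_expectation(1)[OF t'(1), of "\<lambda>h. value_at open_T t (\<kappa> t h) (h t)"]])
       (simp add: \<kappa>[OF t'(2)] X_hist)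
  show a: "integrable W ?a"
    by (rule cong[OF _ history_expectation(1)[OF t'(1),
              of "\<lambda>h. action_cost open_T (T - t) (\<kappa> t h) (h t) (\<phi> t h)"]])
       (simp add: \<kappa>[OF t'(2)] X_hist \<phi>[OF t])
  show c: "integrable W ?c"
    by (rule cong[OF _ expectation_next_state(1)[OF t, of "\<lambda>h. stage_cost t (\<phi> t h)"]])
       (simp add: \<phi>[OF t])
  show V': "integrable W ?V'"
  proof (rule cong[OF _ expectation_next_state(1)[OF t,
              of "\<lambda>h. value_at open_T (t+1) (\<kappa> t h - \<phi> t h)"]])
    fix \<omega> assume \<omega>: "\<omega> \<in> space W"
    show "?V' \<omega> = value_at open_T (t+1) (\<kappa> t (history t \<omega>) - \<phi> t (history t \<omega>)) (X (t+1) \<omega>)"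
      unfolding rem \<phi>[OF t \<omega>] \<kappa>[OF t'(2) \<omega>] by (rule refl)
  qed
  let ?f = "\<lambda>h z. stage_cost t (\<phi> t h) z + value_at open_T (t+1) (\<kappa> t h - \<phi> t h) z"
  have "expectation ?c + expectation ?V' = expectation (\<lambda>\<omega>. ?c \<omega> + ?V' \<omega>)"
    by (rule Bochner_Integration.integral_add[OF c V', symmetric])
  also have "\<dots> = expectation (\<lambda>\<omega>. ?f (history t \<omega>) (X (t+1) \<omega>))"
  proof (rule Bochner_Integration.integral_cong[OF refl])
    fix \<omega> assume \<omega>: "\<omega> \<in> space W"
    show "?c \<omega> + ?V' \<omega> = ?f (history t \<omega>) (X (t+1) \<omega>)"
      unfolding rem \<phi>[OF t \<omega>] \<kappa>[OF t'(2) \<omega>] by (rule refl)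
  qed
  also have "\<dots> = expectation (\<lambda>\<omega>. E_next t (?f (history t \<omega>)) (X t \<omega>))"
    by (rule expectation_next_state(2)[OF t])
  also have "\<dots> = expectation ?a"
  proof (rule Bochner_Integration.integral_cong[OF refl])
    fix \<omega> assume \<omega>: "\<omega> \<in> space W"
    show "E_next t (?f (history t \<omega>)) (X t \<omega>) = ?a \<omega>"
      using E_next_stage_plus_value[OF t X_in_S[OF t'(2) \<omega>] u01[OF \<omega>], of open_T "remaining u t \<omega>"]
      by (simp add: \<phi>[OF t \<omega>] \<kappa>[OF t'(2) \<omega>])
  qed
  finally show "expectation ?c + expectation ?V' = expectation ?a" .
qed

text \<open>
  The performance difference formula: the cost of a control is the Bellman value on day 1 plus the sum of
  the expected losses of its decisions, each measured against the Bellman value on its day.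
\<close>
lemma expected_cost_telescope:
  assumes u: "feasible open_T u"
  shows "expected_cost u = expectation (\<lambda>\<omega>. value_at open_T 1 M (X 1 \<omega>))
    + (\<Sum>t=1..T. expectation (\<lambda>\<omega>. action_cost open_T (T - t) (remaining u t \<omega>) (X t \<omega>) (u t \<omega>)
                                   - value_at open_T t (remaining u t \<omega>) (X t \<omega>)))"
proof -
  let ?V = "\<lambda>t. expectation (\<lambda>\<omega>. value_at open_T t (remaining u t \<omega>) (X t \<omega>))"
  let ?a = "\<lambda>t \<omega>. action_cost open_T (T - t) (remaining u t \<omega>) (X t \<omega>) (u t \<omega>)"
  have telescope: "(\<Sum>t=1..T. ?V (Suc t) - ?V t) = ?V (Suc T) - ?V 1"
    by (rule sum_Suc_diff) simp
  have "expected_cost u = (\<Sum>t=1..T. expectation (\<lambda>\<omega>. stage_cost t (u t \<omega>) (X (t+1) \<omega>)))"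
    unfolding expected_cost_def stage_cost_def[symmetric]
    by (rule Bochner_Integration.integral_sum) (rule one_day(3)[OF u])
  also have "\<dots> = (\<Sum>t=1..T. expectation (?a t) - ?V t - (?V (Suc t) - ?V t))"
    using one_day(5)[OF u] by (intro sum.cong) (simp_all add: algebra_simps)
  also have "\<dots> = (\<Sum>t=1..T. expectation (?a t) - ?V t) - (?V (Suc T) - ?V 1)"
    by (subst sum_subtractf) (simp only: telescope)
  also have "?V (Suc T) = 0" by (simp add: value_at_def)
  also have "(\<Sum>t=1..T. expectation (?a t) - ?V t)
      = (\<Sum>t=1..T. expectation (\<lambda>\<omega>. ?a t \<omega> - value_at open_T t (remaining u t \<omega>) (X t \<omega>)))"
    using one_day(1,4)[OF u] by (intro sum.cong) auto
  finally show ?thesis by (simp add: remaining_def)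
qed

text \<open>
  Feasibility is what makes every loss nonnegative: the budget guarantees that a called event is
  still available, and a closed day \<open>T\<close> sees no event.
\<close>
lemma expected_cost_lower_bound:
  assumes u: "feasible open_T u"
  shows "expectation (\<lambda>\<omega>. value_at open_T 1 M (X 1 \<omega>)) \<le> expected_cost u"
proof -
  have "value_at open_T t (remaining u t \<omega>) (X t \<omega>)
      \<le> action_cost open_T (T - t) (remaining u t \<omega>) (X t \<omega>) (u t \<omega>)"
    if t: "t \<in> {1..T}" and \<omega>: "\<omega> \<in> space W" for t \<omega>
  proof -
    have *: "u t \<omega> \<in> {0, 1}" "(\<Sum>s=1..T. u s \<omega>) \<le> M" "open_T \<or> u T \<omega> = 0"
      using u t \<omega> by (auto simp: feasible_def)
    have "(\<Sum>s\<in>{1..<t}. u s \<omega>) + u t \<omega> = (\<Sum>s=1..t. u s \<omega>)"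
      using t by (simp add: atLeastLessThanSuc_atLeastAtMost[symmetric])
    also have "\<dots> \<le> (\<Sum>s=1..T. u s \<omega>)"
      using t by (intro sum_mono2) auto
    finally have "u t \<omega> = 1 \<Longrightarrow> remaining u t \<omega> \<ge> 1"
      using *(2) by (simp add: remaining_def)
    moreover have "u t \<omega> = 1 \<Longrightarrow> T - t \<ge> 1 \<or> open_T"
      using *(3) t by (cases "t = T") auto
    ultimately show ?thesis
      using best_le_action_cost[OF *(1)] t by (simp add: value_at_def)
  qed
  then have "0 \<le> (\<Sum>t=1..T. expectation (\<lambda>\<omega>.
      action_cost open_T (T - t) (remaining u t \<omega>) (X t \<omega>) (u t \<omega>)
      - value_at open_T t (remaining u t \<omega>) (X t \<omega>)))"
    by (intro sum_nonneg Bochner_Integration.integral_nonneg) (simp del: One_nat_def)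
  then show ?thesis
    unfolding expected_cost_telescope[OF u] by linarith
qed

\<comment> \<open>The recursion is guarded only by the range of summation, so rewriting with it does not terminate.\<close>
declare decision.simps [simp del]

lemma decision_cong:
  assumes "\<And>s. s \<in> {1..t} \<Longrightarrow> x s = x' s" "t \<ge> 1"
  shows "decision open_T x t = decision open_T x' t"
  using assms
proof (induction t rule: less_induct)
  case (less t)
  have "(\<Sum>s\<in>{1..<t}. decision open_T x s) = (\<Sum>s\<in>{1..<t}. decision open_T x' s)"
    using less by (intro sum.cong) auto
  then show ?case using less.prems
    by (subst (1 2) decision.simps) auto
qed

text \<open>
  An event is called only if the truncated difference of budget and events so far is positive.
\<close>
lemma decisions_within_budget:
  "(\<Sum>s\<in>{1..<Suc t}. decision open_T x s) \<le> M"
proof (induction t)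
  case (Suc t)
  have "decision open_T x (Suc t) \<le> M - (\<Sum>s\<in>{1..<Suc t}. decision open_T x s)"
    by (subst decision.simps) (auto simp: calls_def)
  then show ?case using Suc by (simp)
qed simp

lemma cpp_policy_feasible: "feasible open_T (cpp_policy open_T)"
  unfolding feasible_def
proof (intro conjI ballI)
  show "adapted (cpp_policy open_T)"
    unfolding adapted_def cpp_policy_def
  proof (intro ballI exI)
    fix t \<omega> assume "t \<in> {1..T}"
    then show "decision open_T (\<lambda>s. X s \<omega>) t
        = (\<lambda>h. decision open_T h t) (restrict (\<lambda>s. X s \<omega>) {1..t})"
      by (auto intro: decision_cong)
  qed
next
  fix \<omega> t
  show "cpp_policy open_T t \<omega> \<in> {0, 1}"
    unfolding cpp_policy_def by (subst decision.simps) (simp add: of_bool_def)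
next
  fix \<omega>
  show "(\<Sum>t=1..T. cpp_policy open_T t \<omega>) \<le> M"
    using decisions_within_budget[where t = T and open_T = open_T and x = "\<lambda>s. X s \<omega>"]
    by (simp add: cpp_policy_def atLeastLessThanSuc_atLeastAtMost)
next
  fix \<omega>
  show "open_T \<or> cpp_policy open_T T \<omega> = 0"
    unfolding cpp_policy_def by (subst decision.simps) (simp add: calls_def)
qed

lemma cpp_policy_attains_value:
  assumes B: "\<And>t. t \<in> {2..T} \<Longrightarrow> B t > 0"
  shows "expected_cost (cpp_policy open_T) = expectation (\<lambda>\<omega>. value_at open_T 1 M (X 1 \<omega>))"
proof -
  let ?u = "cpp_policy open_T"
  have "action_cost open_T (T - t) (remaining ?u t \<omega>) (X t \<omega>) (?u t \<omega>)
      = value_at open_T t (remaining ?u t \<omega>) (X t \<omega>)"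
    if t: "t \<in> {1..T}" and \<omega>: "\<omega> \<in> space W" for t \<omega>
  proof -
    have "?u t \<omega> = of_bool (calls open_T (T - t) (remaining ?u t \<omega>) (X t \<omega>))"
      unfolding cpp_policy_def remaining_def by (subst decision.simps) (rule refl)
    moreover have "T - t < T" using t by auto
    ultimately show ?thesis
      using best_eq_calls[OF _ X_in_S[of t \<omega>] B, of "T - t" open_T] t \<omega>
      by (simp add: value_at_def)
  qed
  then have "expectation (\<lambda>\<omega>. action_cost open_T (T - t) (remaining ?u t \<omega>) (X t \<omega>) (?u t \<omega>)
      - value_at open_T t (remaining ?u t \<omega>) (X t \<omega>)) = 0" if "t \<in> {1..T}" for t
    using that by (subst Bochner_Integration.integral_cong[OF refl, where g = "\<lambda>_. 0"]) auto
  then show ?thesis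
    unfolding expected_cost_telescope[OF cpp_policy_feasible] by simp
qed

lemma cpp_policy_optimal:
  assumes "\<And>t. t \<in> {2..T} \<Longrightarrow> B t > 0"
  shows "optimal open_T (cpp_policy open_T)"
  using cpp_policy_feasible expected_cost_lower_bound cpp_policy_attains_value[OF assms]
  by (simp add: optimal_def)


section \<open>When no event pays off on the last day\<close>

lemma g_open_T_irrelevant:
  assumes "\<forall>\<xi>\<in>S. E_full 0 \<xi> \<le> abar (T + 1) + E_curt 0 \<xi>"
  shows "g True d k x = g False d k x"
proof (induction d arbitrary: k x)
  case 0
  show ?case using assms by (auto intro!: sum.cong)
next
  case (Suc d)
  then show ?case by (cases k) auto
qed

lemma cpp_policy_open_T_irrelevant:
  assumes le: "\<forall>\<xi>\<in>S. E_full 0 \<xi> \<le> abar (T + 1) + E_curt 0 \<xi>"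
    and \<omega>: "\<omega> \<in> space W" and "t \<in> {1..T}"
  shows "cpp_policy False t \<omega> = cpp_policy True t \<omega>"
  using assms(3) unfolding cpp_policy_def
proof (induction t rule: less_induct)
  case (less t)
  have "(\<Sum>s\<in>{1..<t}. decision False (\<lambda>s. X s \<omega>) s) = (\<Sum>s\<in>{1..<t}. decision True (\<lambda>s. X s \<omega>) s)"
    using less by (intro sum.cong) auto
  moreover have "X t \<omega> \<in> S" using less.prems \<omega> by (intro X_in_S) auto
  ultimately show ?case using le
    by (subst (1 2) decision.simps) (auto simp: calls_def g_open_T_irrelevant[OF le])
qed

lemma optimal_cong:
  assumes eq: "\<And>t \<omega>. t \<in> {1..T} \<Longrightarrow> \<omega> \<in> space W \<Longrightarrow> u t \<omega> = v t \<omega>" and v: "optimal open_T v"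
  shows "optimal open_T u"
proof -
  have sum_eq: "(\<Sum>t=1..T. u t \<omega>) = (\<Sum>t=1..T. v t \<omega>)" if "\<omega> \<in> space W" for \<omega>
    using eq that by (intro sum.cong) auto
  have "adapted u" using v eq unfolding optimal_def feasible_def adapted_def by metis
  then have "feasible open_T u"
    using v eq sum_eq T_pos unfolding optimal_def feasible_def by auto
  moreover have "expected_cost u = expected_cost v"
    unfolding expected_cost_def using eq by (intro Bochner_Integration.integral_cong sum.cong) auto
  ultimately show ?thesis using v by (simp add: optimal_def)
qed

end

theorem proposition4:
  fixes W :: "'w measure"
    and T M :: nat
    and S :: "(real ^ 'n) set"
    and X :: "nat \<Rightarrow> 'w \<Rightarrow> real ^ 'n"
    and P :: "nat \<Rightarrow> real ^ 'n \<Rightarrow> real ^ 'n \<Rightarrow> real"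
    and q :: "nat \<Rightarrow> real ^ 'n \<Rightarrow> real"
    and B C D abar :: "nat \<Rightarrow> real"
    and y :: real
    and open_T :: bool
  assumes "cpp_problem W T S X P B C D y"
    and "\<And>t. t \<in> {2..T} \<Longrightarrow> B t > 0"
  shows "cpp_problem.optimal W T M X q B C D abar y open_T
           (cpp_problem.cpp_policy T M S X P q B C D abar y open_T)
       \<and> ((\<forall>\<xi>\<in>S. cpp_problem.E_full T S P q B C D 0 \<xi>
                 \<le> abar (T + 1) + cpp_problem.E_curt T S P q B C D y 0 \<xi>) \<longrightarrow>
          cpp_problem.optimal W T M X q B C D abar y True
            (cpp_problem.cpp_policy T M S X P q B C D abar y False))"
proof -
  interpret cpp_problem W T M S X P q B C D abar y by (rule assms(1))
  note optimal = cpp_policy_optimal[OF assms(2)]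
  show ?thesis
    using optimal optimal_cong[OF cpp_policy_open_T_irrelevant optimal] by blast
qed

end
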